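(* Let $G$ be a compact group with normalized Haar measure $\mu$, let $\pi:G\to U(\mathcal H)$ be a unitary representation on a finite-dimensional complex Hilbert space $\mathcal H$ with $d=\dim\mathcal H>1$, and suppose that for some unitary $U$ $$U\pi(g)U^*=\bigoplus_{\alpha=1}^{s}\bigl(I_{m_\alpha}\otimes\pi_\alpha(g)\bigr),\qquad g\in G,$$ where $\pi_1,\dots,\pi_s$ are pairwise inequivalent irreducible unitary representations of $G$ and $m_\alpha\ge 1$ is the multiplicity of $\pi_\alpha$. Let $\Phi_\pi(\rho)=\int_G\pi(g)\rho\,\pi(g^{-1})\,d\mu(g)$ be the twirling channel associated with $\pi$. If $\sum_{\alpha=1}^{s}m_\alpha^{2}\le N(d)$, then $\Phi_\pi$ is not phase retrievable.
   Context: Representations are continuous. $\Phi_\pi:B(\mathcal H)\to B(\mathcal H)$ is a quantum channel (completely positive trace preserving map), and $\Phi_\pi^*$ denotes its adjoint for the Hilbert–Schmidt inner product. For a unit vector $x$, $\rho_x=|x\rangle\langle x|$. A POVM on $\mathcal H$ is a finite family of positive semidefinite operators summing to $I_{\mathcal H}$. Phase retrievable: a quantum channel $\Phi:B(\mathcal H)\to B(\mathcal K)$ is phase retrievable if there exists a POVM $\{F_j\}_{j=1}^{N}$ on $\mathcal K$ such that, for all unit vectors $x,y\in\mathcal H$, $\operatorname{Tr}(\rho_x\Phi^*(F_j))=\operatorname{Tr}(\rho_y\Phi^*(F_j))$ for all $j$ implies $\rho_x=\rho_y$. Definition of $N(d)$ for an integer $d>1$: let $\alpha_0$ be the number of $1$'s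 in the binary expansion of $d-1$ and $D=2d-2$. Then $N(d)=2D-2\alpha_0+2$ if $d$ is odd and $\alpha_0\equiv 3\pmod 4$; $N(d)=2D-2\alpha_0+1$ if $d$ is odd and $\alpha_0\equiv 2\pmod 4$; and $N(d)=2D-2\alpha_0$ otherwise. *)

theory Defs
  imports
    "HOL-Analysis.Analysis"
    "HOL-Algebra.Coset"
    "Jordan_Normal_Form.Schur_Decomposition"
    "Jordan_Normal_Form.VS_Connect"
begin

text \<open>
  A complex Hilbert space of dimension \<open>d\<close> is \<open>carrier_vec d\<close> with the inner product \<open>\<bullet>c\<close>,
  and its algebra of operators is \<open>carrier_mat d d\<close>.
\<close>

definition compact_group :: "('g, 'b) monoid_scheme \<Rightarrow> 'g topology \<Rightarrow> bool" where
  "compact_group G T \<longleftrightarrow>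
     group G \<and> topspace T = carrier G \<and>
     continuous_map (prod_topology T T) T (\<lambda>(g, h). g \<otimes>\<^bsub>G\<^esub> h) \<and>
     continuous_map T T (\<lambda>g. inv\<^bsub>G\<^esub> g) \<and>
     compact_space T \<and> Hausdorff_space T"

definition normalized_haar_measure ::
    "('g, 'b) monoid_scheme \<Rightarrow> 'g topology \<Rightarrow> 'g measure \<Rightarrow> bool" where
  "normalized_haar_measure G T \<mu> \<longleftrightarrow>
     sets \<mu> = sets (sigma (topspace T) {V. openin T V}) \<and>
     emeasure \<mu> (space \<mu>) = 1 \<and>
     (\<forall>g\<in>carrier G. \<forall>A\<in>sets \<mu>. emeasure \<mu> (g <#\<^bsub>G\<^esub> A) = emeasure \<mu> A) \<and>
     (\<forall>A\<in>sets \<mu>. emeasure \<mu> A = (INF V\<in>{V. openin T V \<and> A \<subseteq> V}. emeasure \<mu> V)) \<and>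
     (\<forall>V. openin T V \<longrightarrow> emeasure \<mu> V = (SUP K\<in>{K. compactin T K \<and> K \<subseteq> V}. emeasure \<mu> K))"

definition mat_trace :: "complex mat \<Rightarrow> complex" where
  "mat_trace A = (\<Sum>i<dim_row A. A $$ (i, i))"

definition unitary_mat :: "nat \<Rightarrow> complex mat \<Rightarrow> bool" where
  "unitary_mat d A \<longleftrightarrow>
     A \<in> carrier_mat d d \<and> A * mat_adjoint A = 1\<^sub>m d \<and> mat_adjoint A * A = 1\<^sub>m d"

text \<open>The order on \<^typ>\<open>complex\<close> is the one where \<open>0 \<le> z\<close> means that \<open>z\<close> is real and nonnegative.\<close>

definition psd_mat :: "nat \<Rightarrow> complex mat \<Rightarrow> bool" where
  "psd_mat d A \<longleftrightarrow> A \<in> carrier_mat d d \<and> (\<forall>v\<in>carrier_vec d. 0 \<le> (A *\<^sub>v v) \<bullet>c v)"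

definition kronecker :: "complex mat \<Rightarrow> complex mat \<Rightarrow> complex mat" where
  "kronecker A B =
     mat (dim_row A * dim_row B) (dim_col A * dim_col B)
       (\<lambda>(i, j). A $$ (i div dim_row B, j div dim_col B) * B $$ (i mod dim_row B, j mod dim_col B))"

definition pure_state :: "complex vec \<Rightarrow> complex mat" where
  "pure_state x = mat (dim_vec x) (dim_vec x) (\<lambda>(i, j). x $ i * cnj (x $ j))"

definition unit_vector :: "nat \<Rightarrow> complex vec \<Rightarrow> bool" where
  "unit_vector d x \<longleftrightarrow> x \<in> carrier_vec d \<and> x \<bullet>c x = 1"

definition unitary_representation ::
    "('g, 'b) monoid_scheme \<Rightarrow> 'g topology \<Rightarrow> nat \<Rightarrow> ('g \<Rightarrow> complex mat) \<Rightarrow> bool" where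
  "unitary_representation G T d \<pi> \<longleftrightarrow>
     (\<forall>g\<in>carrier G. unitary_mat d (\<pi> g)) \<and>
     (\<forall>g\<in>carrier G. \<forall>h\<in>carrier G. \<pi> (g \<otimes>\<^bsub>G\<^esub> h) = \<pi> g * \<pi> h) \<and>
     (\<forall>i<d. \<forall>j<d. continuous_map T euclidean (\<lambda>g. \<pi> g $$ (i, j)))"

definition irreducible_representation ::
    "('g, 'b) monoid_scheme \<Rightarrow> nat \<Rightarrow> ('g \<Rightarrow> complex mat) \<Rightarrow> bool" where
  "irreducible_representation G d \<pi> \<longleftrightarrow>
     0 < d \<and>
     (\<forall>W. VectorSpace.subspace class_ring W (module_vec TYPE(complex) d) \<and>
          (\<forall>g\<in>carrier G. \<forall>v\<in>W. \<pi> g *\<^sub>v v \<in> W) \<longrightarrow>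
          W = {0\<^sub>v d} \<or> W = carrier_vec d)"

definition equivalent_representations ::
    "('g, 'b) monoid_scheme \<Rightarrow> nat \<Rightarrow> ('g \<Rightarrow> complex mat) \<Rightarrow> nat \<Rightarrow> ('g \<Rightarrow> complex mat) \<Rightarrow> bool" where
  "equivalent_representations G d \<pi> d' \<pi>' \<longleftrightarrow>
     (\<exists>S\<in>carrier_mat d' d. invertible_mat S \<and> (\<forall>g\<in>carrier G. S * \<pi> g = \<pi>' g * S))"

text \<open>The integral of a matrix-valued function is taken entrywise.\<close>

definition twirling_channel ::
    "('g, 'b) monoid_scheme \<Rightarrow> 'g measure \<Rightarrow> nat \<Rightarrow> ('g \<Rightarrow> complex mat) \<Rightarrow> complex mat \<Rightarrow> complex mat"
  where
  "twirling_channel G \<mu> d \<pi> \<rho> =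
     mat d d (\<lambda>(i, j). LINT g|\<mu>. (\<pi> g * \<rho> * \<pi> (inv\<^bsub>G\<^esub> g)) $$ (i, j))"

definition hs_inner :: "complex mat \<Rightarrow> complex mat \<Rightarrow> complex" where
  "hs_inner A B = mat_trace (mat_adjoint A * B)"

text \<open>The operator below is unique by nondegeneracy of the Hilbert--Schmidt inner product, and it exists
  whenever \<open>\<Phi>\<close> is linear on \<open>carrier_mat d d\<close>.\<close>

definition hs_adjoint ::
    "nat \<Rightarrow> (complex mat \<Rightarrow> complex mat) \<Rightarrow> complex mat \<Rightarrow> complex mat" where
  "hs_adjoint d \<Phi> B =
     (THE A. A \<in> carrier_mat d d \<and> (\<forall>X\<in>carrier_mat d d. hs_inner X A = hs_inner (\<Phi> X) B))"

definition povm :: "nat \<Rightarrow> nat \<Rightarrow> (nat \<Rightarrow> complex mat) \<Rightarrow> bool" where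
  "povm d N F \<longleftrightarrow>
     (\<forall>j<N. psd_mat d (F j)) \<and>
     mat d d (\<lambda>(a, b). \<Sum>j<N. F j $$ (a, b)) = 1\<^sub>m d"

text \<open>
  The map \<open>\<Phi>\<close> sends operators on a Hilbert space of dimension \<open>d\<close> to operators on one of
  dimension \<open>k\<close>. That \<open>\<Phi>\<close> is a quantum channel is not part of the predicate, so a negated
  instance cannot hold merely because complete positivity or trace preservation fails.
\<close>

definition phase_retrievable :: "nat \<Rightarrow> nat \<Rightarrow> (complex mat \<Rightarrow> complex mat) \<Rightarrow> bool" where
  "phase_retrievable d k \<Phi> \<longleftrightarrow>
     (\<exists>N F. povm k N F \<and>
        (\<forall>x y. unit_vector d x \<and> unit_vector d y \<and>
           (\<forall>j<N. mat_trace (pure_state x * hs_adjoint d \<Phi> (F j)) =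
                  mat_trace (pure_state y * hs_adjoint d \<Phi> (F j))) \<longrightarrow>
           pure_state x = pure_state y))"

definition binary_ones :: "nat \<Rightarrow> nat" where
  "binary_ones n = card {i. bit n i}"

definition N_bound :: "nat \<Rightarrow> int" where
  "N_bound d =
     (let \<alpha>0 = binary_ones (d - 1); D = 2 * int d - 2 in
      if odd d \<and> \<alpha>0 mod 4 = 3 then 2 * D - 2 * int \<alpha>0 + 2
      else if odd d \<and> \<alpha>0 mod 4 = 2 then 2 * D - 2 * int \<alpha>0 + 1
      else 2 * D - 2 * int \<alpha>0)"

end

theory Submission
  imports Defs
begin

text \<open>
  The channel does not distinguish \<open>\<rho>\<^sub>x\<close> from \<open>\<rho>\<^sub>y\<close> for \<open>y = \<pi>(h) x\<close>. If it were phase retrievable, every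
  \<open>\<pi>(h)\<close> would thus fix all pure states and be a scalar. Then every \<open>\<pi>\<^sub>\<alpha>\<close> is one-dimensional, all of them
  coincide, and inequivalence leaves \<open>s = 1\<close> and \<open>m\<^sub>1 = d\<close>. But \<open>N(d) < 4 d - 4 \<le> d\<^sup>2\<close>, so the hypothesis
  on the multiplicities fails.
\<close>

subsection \<open>Matrices and the Hilbert--Schmidt inner product\<close>

text \<open>Outcome probabilities see a state only through its image, since Tr(rho Phi^*(F)) is the
  Hilbert-Schmidt product of Phi(rho) with F. Two obstacles stand before this use of the channel.
  First, \<open>hs_adjoint\<close> is a definite description, which says nothing until an adjoint is
  exhibited and proved unique; an explicit integral supplies it. Second, Phi(rho_x) = Phi(rho_y)
  asks for a right translation under the integral, whereas \<open>normalized_haar_measure\<close>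
  provides left translations. The way around is geometric: left invariance makes the twirl the
  orthogonal projection onto the commutant of \<pi>, and the commutant cannot tell an operator from
  its conjugate by \<pi>(h). At the end it matters that the scalar c with \<pi>(g) = c I is the same
  in every block of the decomposition: this is what makes the irreducible constituents equal as
  functions on G, not merely scalar one by one.\<close>

lemma mat_mult_entry:
  assumes "A \<in> carrier_mat n m" "B \<in> carrier_mat m k" "i < n" "j < k"
  shows "(A * B) $$ (i, j) = (\<Sum>l<m. A $$ (i, l) * B $$ (l, j))"
  using assms by (auto simp: scalar_prod_def atLeast0LessThan intro!: sum.cong)

lemma mat_mult3_entry:
  assumes "A \<in> carrier_mat n n" "B \<in> carrier_mat n n" "C \<in> carrier_mat n n" "i < n" "j < n"
  shows "(A * B * C) $$ (i, j) = (\<Sum>l<n. \<Sum>k<n. A $$ (i, k) * B $$ (k, l) * C $$ (l, j))"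
proof -
  have "(A * B * C) $$ (i, j) = (\<Sum>l<n. (A * B) $$ (i, l) * C $$ (l, j))"
    using assms by (intro mat_mult_entry[of _ n n]) auto
  also have "\<dots> = (\<Sum>l<n. \<Sum>k<n. A $$ (i, k) * B $$ (k, l) * C $$ (l, j))"
    using assms by (intro sum.cong) (auto simp: mat_mult_entry[of A n n B n] sum_distrib_right simp del: index_mult_mat(1))
  finally show ?thesis .
qed

lemma mat_adjoint_dim [simp]:
  "dim_row (mat_adjoint A) = dim_col A" "dim_col (mat_adjoint A) = dim_row A"
  unfolding mat_adjoint_def by auto

lemma mat_adjoint_carrier [simp]: "A \<in> carrier_mat n m \<Longrightarrow> mat_adjoint A \<in> carrier_mat m n"
  by auto

lemma mat_adjoint_entry:
  assumes "A \<in> carrier_mat n m" "i < m" "j < n"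
  shows "mat_adjoint A $$ (i, j) = cnj (A $$ (j, i))"
  using assms unfolding mat_adjoint_def by (auto simp: mat_of_rows_index)

lemma mat_adjoint_mult:
  assumes "A \<in> carrier_mat n m" "B \<in> carrier_mat m k"
  shows "mat_adjoint (A * B :: complex mat) = mat_adjoint B * mat_adjoint A"
proof (rule eq_matI)
  fix i j assume "i < dim_row (mat_adjoint B * mat_adjoint A)" "j < dim_col (mat_adjoint B * mat_adjoint A)"
  with assms have ij: "i < k" "j < n" by (auto dest: mat_adjoint_carrier)
  have AB: "A * B \<in> carrier_mat n k" using assms by simp
  show "mat_adjoint (A * B) $$ (i, j) = (mat_adjoint B * mat_adjoint A) $$ (i, j)"
    unfolding mat_adjoint_entry[OF AB ij] mat_mult_entry[OF assms ij(2,1)]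
      mat_mult_entry[OF mat_adjoint_carrier[OF assms(2)] mat_adjoint_carrier[OF assms(1)] ij]
    using assms ij by (simp add: mat_adjoint_entry[of A n m] mat_adjoint_entry[of B m k] mult.commute)
qed (use assms in \<open>auto dest: mat_adjoint_carrier\<close>)

lemma mat_trace_comm:
  assumes "A \<in> carrier_mat n m" "B \<in> carrier_mat m n"
  shows "mat_trace (A * B) = mat_trace (B * A)"
proof -
  have "mat_trace (A * B) = (\<Sum>i<n. \<Sum>l<m. A $$ (i, l) * B $$ (l, i))"
    using assms unfolding mat_trace_def by (auto simp: mat_mult_entry[of A n m B n] simp del: index_mult_mat(1))
  also have "\<dots> = (\<Sum>l<m. \<Sum>i<n. B $$ (l, i) * A $$ (i, l))"
    by (subst sum.swap) (simp add: mult.commute)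
  also have "\<dots> = mat_trace (B * A)"
    using assms unfolding mat_trace_def by (auto simp: mat_mult_entry[of B m n A m] simp del: index_mult_mat(1))
  finally show ?thesis .
qed

lemma mat_trace_minus:
  assumes "A \<in> carrier_mat n n" "B \<in> carrier_mat n n"
  shows "mat_trace (A - B) = mat_trace A - mat_trace B"
  using assms unfolding mat_trace_def by (auto simp: sum_subtractf)

lemma hs_inner_minus:
  assumes "C \<in> carrier_mat n n" "A \<in> carrier_mat n n" "B \<in> carrier_mat n n"
  shows "hs_inner C (A - B) = hs_inner C A - hs_inner C B"
  unfolding hs_inner_def mult_minus_distrib_mat[OF mat_adjoint_carrier[OF assms(1)] assms(2,3)]
  using assms by (intro mat_trace_minus[of _ n]) (auto dest: mat_adjoint_carrier)

text \<open>The product of A with itself is the sum of the squared moduli of its entries. Uniqueness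
  of adjoints and \<open>twirl_conj\<close> both rest on this definiteness.\<close>

lemma hs_inner_self_eq_0:
  assumes A: "A \<in> carrier_mat n n" and 0: "hs_inner A A = 0"
  shows "A = 0\<^sub>m n n"
proof -
  have "hs_inner A A = (\<Sum>i<n. \<Sum>l<n. of_real ((cmod (A $$ (l, i)))\<^sup>2))"
    using A mat_adjoint_carrier[OF A] unfolding hs_inner_def mat_trace_def
    by (auto simp: mat_mult_entry[of "mat_adjoint A" n n A n] mat_adjoint_entry[of A n n]
        complex_norm_square mult.commute simp del: index_mult_mat(1) of_real_power intro!: sum.cong)
  also have "\<dots> = of_real (\<Sum>i<n. \<Sum>l<n. (cmod (A $$ (l, i)))\<^sup>2)" by simp
  finally have "(\<Sum>i<n. \<Sum>l<n. (cmod (A $$ (l, i)))\<^sup>2) = 0"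
    using 0 by (metis of_real_eq_0_iff)
  hence "\<forall>i<n. \<forall>l<n. A $$ (l, i) = 0"
    by (simp add: sum_nonneg_eq_0_iff sum_nonneg)
  thus ?thesis using A by (intro eq_matI) auto
qed

text \<open>Releases the \<open>THE\<close> in \<open>hs_adjoint\<close> once some solution A is
  known: the difference of two solutions is orthogonal to every matrix, in particular to
  itself.\<close>

lemma hs_adjoint_inner:
  assumes A: "A \<in> carrier_mat d d" and eq: "\<And>X. X \<in> carrier_mat d d \<Longrightarrow> hs_inner X A = hs_inner (\<Phi> X) B"
    and X: "X \<in> carrier_mat d d"
  shows "hs_inner X (hs_adjoint d \<Phi> B) = hs_inner (\<Phi> X) B"
proof -
  have "hs_adjoint d \<Phi> B = A"
    unfolding hs_adjoint_def
  proof (rule the_equality)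
    fix A' assume "A' \<in> carrier_mat d d \<and> (\<forall>X\<in>carrier_mat d d. hs_inner X A' = hs_inner (\<Phi> X) B)"
    hence A': "A' \<in> carrier_mat d d" and "\<And>X. X \<in> carrier_mat d d \<Longrightarrow> hs_inner X A' = hs_inner X A"
      using eq by auto
    moreover have "A' - A \<in> carrier_mat d d" using A by (rule minus_carrier_mat)
    ultimately have "hs_inner (A' - A) (A' - A) = 0"
      using A A' by (simp add: hs_inner_minus[of _ d])
    hence "A' - A = 0\<^sub>m d d"
      using A by (intro hs_inner_self_eq_0) auto
    hence "(A' - A) $$ (i, j) = 0" if "i < d" "j < d" for i j using that by simp
    thus "A' = A" using A A' by (intro eq_matI) auto
  qed (use A eq in auto)
  thus ?thesis using eq[OF X] by simp
qed

subsection \<open>Pure states and scalar unitaries\<close>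

text \<open>Each row of a unitary matrix has norm 1. This is the uniform bound behind every
  integrability claim about the representation.\<close>

lemma unitary_entry_le_1:
  assumes "unitary_mat d A" "i < d" "j < d"
  shows "cmod (A $$ (i, j)) \<le> 1"
proof -
  have A: "A \<in> carrier_mat d d" and AA: "A * mat_adjoint A = 1\<^sub>m d"
    using assms unfolding unitary_mat_def by auto
  have "complex_of_real (\<Sum>l<d. (cmod (A $$ (i, l)))\<^sup>2) = (A * mat_adjoint A) $$ (i, i)"
    using A assms mat_adjoint_carrier[OF A]
    by (auto simp: mat_mult_entry[of A d d _ d] mat_adjoint_entry[of A d d]
        complex_norm_square simp del: index_mult_mat(1) of_real_power intro!: sum.cong)
  also have "\<dots> = of_real 1" using AA assms by simp
  finally have "(\<Sum>l<d. (cmod (A $$ (i, l)))\<^sup>2) = 1" using of_real_eq_iff by blast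
  moreover have "(cmod (A $$ (i, j)))\<^sup>2 \<le> (\<Sum>l<d. (cmod (A $$ (i, l)))\<^sup>2)"
    using assms by (intro member_le_sum) auto
  ultimately show ?thesis by (simp add: power2_nonneg_ge_1_iff abs_square_le_1)
qed

lemma pure_state_carrier: "x \<in> carrier_vec d \<Longrightarrow> pure_state x \<in> carrier_mat d d"
  unfolding pure_state_def by auto

lemma pure_state_adjoint: "mat_adjoint (pure_state x) = pure_state x"
proof -
  have c: "pure_state x \<in> carrier_mat (dim_vec x) (dim_vec x)" by (simp add: pure_state_def)
  show ?thesis
    using carrier_matD[OF c]
    by (intro eq_matI) (simp_all add: mat_adjoint_entry[OF c] del: carrier_matD, simp_all add: pure_state_def)
qed

lemma mat_trace_pure_state: "x \<in> carrier_vec d \<Longrightarrow> mat_trace (pure_state x) = x \<bullet>c x"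
  unfolding mat_trace_def pure_state_def by (auto simp: scalar_prod_def atLeast0LessThan)

lemma pure_state_mult_mat_vec:
  assumes A: "A \<in> carrier_mat d d" and x: "x \<in> carrier_vec d"
  shows "pure_state (A *\<^sub>v x) = A * pure_state x * mat_adjoint A"
proof (rule eq_matI)
  fix i j assume "i < dim_row (A * pure_state x * mat_adjoint A)" "j < dim_col (A * pure_state x * mat_adjoint A)"
  with A have ij: "i < d" "j < d" using mat_adjoint_carrier[OF A] by auto
  have "(A * pure_state x * mat_adjoint A) $$ (i, j) =
      (\<Sum>l<d. \<Sum>k<d. A $$ (i, k) * pure_state x $$ (k, l) * mat_adjoint A $$ (l, j))"
    using ij A x by (intro mat_mult3_entry) (auto dest: pure_state_carrier)
  also have "\<dots> = (\<Sum>l<d. \<Sum>k<d. (A $$ (i, k) * x $ k) * cnj (A $$ (j, l) * x $ l))"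
    using x ij A by (intro sum.cong) (auto simp: pure_state_def mat_adjoint_entry[OF A])
  also have "\<dots> = (A *\<^sub>v x) $ i * cnj ((A *\<^sub>v x) $ j)"
    using ij A x by (subst sum.swap)
      (auto simp: scalar_prod_def atLeast0LessThan sum_product simp del: complex_cnj_mult)
  finally show "pure_state (A *\<^sub>v x) $$ (i, j) = (A * pure_state x * mat_adjoint A) $$ (i, j)"
    using ij A by (simp add: pure_state_def)
qed (use A in \<open>auto simp: pure_state_def dest: mat_adjoint_carrier\<close>)

text \<open>Basis vectors as test states force A to be diagonal with unimodular entries;
  superpositions of two basis vectors then force these phases to agree.\<close>

lemma scalar_of_fixes_pure_states:
  assumes A: "unitary_mat d A" and d: "0 < d"
    and fix_states: "\<And>x. unit_vector d x \<Longrightarrow> pure_state (A *\<^sub>v x) = pure_state x"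
  shows "\<exists>c. A = c \<cdot>\<^sub>m 1\<^sub>m d"
proof -
  have Ac: "A \<in> carrier_mat d d" using A unfolding unitary_mat_def by auto
  have eq: "(A *\<^sub>v x) $ i * cnj ((A *\<^sub>v x) $ j) = x $ i * cnj (x $ j)"
    if "unit_vector d x" "i < d" "j < d" for x i j
  proof -
    have "pure_state (A *\<^sub>v x) $$ (i, j) = pure_state x $$ (i, j)"
      using fix_states[OF that(1)] by simp
    thus ?thesis using that Ac by (auto simp: pure_state_def unit_vector_def simp del: index_mult_mat_vec)
  qed
  have unit: "unit_vector d (unit_vec d k)" if "k < d" for k
    using that by (simp add: unit_vector_def scalar_prod_def if_distrib sum.delta cong: if_cong)
  have col: "(A *\<^sub>v unit_vec d k) $ i = A $$ (i, k)" if "k < d" "i < d" for i k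
    using that Ac by simp
  \<comment> \<open>The (i, i) entry of the state of \<open>A\<close> applied to the k-th basis
    vector is the squared modulus of this entry.\<close>
  have off: "A $$ (i, k) = 0" if "i < d" "k < d" "i \<noteq> k" for i k
    using eq[OF unit[of k], of i i] that by (simp add: col del: index_mult_mat_vec)
  have diag: "A $$ (k, k) * cnj (A $$ (k, k)) = 1" if "k < d" for k
    using eq[OF unit[of k], of k k] that by (simp add: col del: index_mult_mat_vec)
  have "A $$ (k, k) = A $$ (0, 0)" if k: "k < d" for k
  proof (cases "k = 0")
    case False
    \<comment> \<open>The Pythagorean triple 3, 4, 5 gives a unit vector with two nonzero
      coordinates and no square roots.\<close>
    define x where "x = vec d (\<lambda>i. if i = 0 then 3 / 5 else if i = k then 4 / 5 else (0::complex))"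
    have s: "(\<Sum>i<d. (if i = 0 then f i else if i = k then g i else 0)) = f 0 + g k" for f g :: "nat \<Rightarrow> complex"
    proof -
      have "(\<Sum>i<d. (if i = 0 then f i else if i = k then g i else 0))
          = (\<Sum>i<d. (if i = 0 then f i else 0) + (if i = k then g i else 0))"
        using False by (intro sum.cong) auto
      thus ?thesis using k d by (simp add: sum.distrib)
    qed
    have x: "unit_vector d x"
    proof -
      have "x \<bullet>c x = (\<Sum>i<d. if i = 0 then 9 / 25 else if i = k then 16 / 25 else 0)"
        unfolding x_def scalar_prod_def by (auto simp: atLeast0LessThan intro!: sum.cong)
      thus ?thesis unfolding s by (simp add: unit_vector_def x_def)
    qed
    have Ax: "(A *\<^sub>v x) $ i = A $$ (i, i) * x $ i" if "i < d" for i
    proof -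
      have "(A *\<^sub>v x) $ i = (\<Sum>l<d. A $$ (i, l) * x $ l)"
        using Ac that by (auto simp: x_def scalar_prod_def atLeast0LessThan intro!: sum.cong)
      also have "\<dots> = (\<Sum>l<d. if l = i then A $$ (i, i) * x $ i else 0)"
        using that off by (intro sum.cong) auto
      finally show ?thesis using that by simp
    qed
    \<comment> \<open>The (k, 0) entry of the state carries the relative phase; the common factor
      12/25 cancels.\<close>
    have "A $$ (k, k) * cnj (A $$ (0, 0)) = 1"
      using eq[OF x k d] k d False by (simp add: Ax del: index_mult_mat_vec) (simp add: x_def)
    hence "A $$ (k, k) * (A $$ (0, 0) * cnj (A $$ (0, 0))) = A $$ (0, 0)"
      by (simp add: ac_simps)
    thus ?thesis using diag[OF d] by simp
  qed simp
  note diag_eq = this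
  define c where "c = A $$ (0, 0)"
  have "A $$ (i, j) = (c \<cdot>\<^sub>m 1\<^sub>m d) $$ (i, j)" if "i < d" "j < d" for i j
    using that off[OF that] diag_eq[of i] by (cases "i = j") (auto simp: c_def)
  hence "A = c \<cdot>\<^sub>m 1\<^sub>m d"
    using Ac by (intro eq_matI) auto
  thus ?thesis ..
qed

subsection \<open>Blocks of scalar matrices\<close>

text \<open>The same c is inherited by all blocks. Squareness keeps the diagonal of each block on
  the diagonal of the whole matrix.\<close>

lemma diag_block_mat_scalar:
  assumes "diag_block_mat As = c \<cdot>\<^sub>m 1\<^sub>m N" and "\<And>A. A \<in> set As \<Longrightarrow> square_mat A" and "A \<in> set As"
  shows "A = c \<cdot>\<^sub>m 1\<^sub>m (dim_row A)"
  using assms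
proof (induction As arbitrary: N)
  case (Cons B As)
  define D where "D = diag_block_mat As"
  have sqB: "dim_col B = dim_row B" using Cons.prems(2)[of B] by simp
  have sqD: "dim_col D = dim_row D"
    using diag_block_mat_square[of As] Cons.prems(2) unfolding D_def by auto
  have eq: "four_block_mat B (0\<^sub>m (dim_row B) (dim_col D)) (0\<^sub>m (dim_row D) (dim_col B)) D = c \<cdot>\<^sub>m 1\<^sub>m N"
    using Cons.prems(1) by (simp add: Let_def D_def)
  have N: "N = dim_row B + dim_row D" using arg_cong[OF eq, of dim_row] by simp
  have B: "B = c \<cdot>\<^sub>m 1\<^sub>m (dim_row B)"
  proof (rule eq_matI)
    fix i j assume "i < dim_row (c \<cdot>\<^sub>m 1\<^sub>m (dim_row B))" "j < dim_col (c \<cdot>\<^sub>m 1\<^sub>m (dim_row B))"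
    thus "B $$ (i, j) = (c \<cdot>\<^sub>m 1\<^sub>m (dim_row B)) $$ (i, j)"
      using arg_cong[OF eq, of "\<lambda>M. M $$ (i, j)"] N sqB by (simp split: if_splits)
  qed (use sqB in auto)
  have D: "D = c \<cdot>\<^sub>m 1\<^sub>m (dim_row D)"
  proof (rule eq_matI)
    fix i j assume "i < dim_row (c \<cdot>\<^sub>m 1\<^sub>m (dim_row D))" "j < dim_col (c \<cdot>\<^sub>m 1\<^sub>m (dim_row D))"
    thus "D $$ (i, j) = (c \<cdot>\<^sub>m 1\<^sub>m (dim_row D)) $$ (i, j)"
      \<comment> \<open>The lower right block starts at row and column \<open>dim_row B\<close>, the
        column offset being the same because \<open>B\<close> is square.\<close>
      using arg_cong[OF eq, of "\<lambda>M. M $$ (dim_row B + i, dim_row B + j)"] N sqB sqD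
      by (simp split: if_splits)
  qed (use sqD in auto)
  show ?case
  proof (cases "A = B")
    case True
    show ?thesis unfolding True by (fact B)
  next
    case False
    hence "A \<in> set As" using Cons.prems(3) by simp
    thus ?thesis by (intro Cons.IH[OF D[unfolded D_def]] Cons.prems(2)) simp_all
  qed
qed simp

text \<open>\<open>B\<close> is the upper left n by n corner of the Kronecker product, which exists
  because m is at least 1.\<close>

lemma kronecker_one_scalar:
  assumes B: "B \<in> carrier_mat n n" and m: "1 \<le> m" and eq: "kronecker (1\<^sub>m m) B = c \<cdot>\<^sub>m 1\<^sub>m N"
  shows "B = c \<cdot>\<^sub>m 1\<^sub>m n"
proof (rule eq_matI)
  fix i j assume "i < dim_row (c \<cdot>\<^sub>m 1\<^sub>m n)" "j < dim_col (c \<cdot>\<^sub>m 1\<^sub>m n)"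
  hence ij: "i < n" "j < n" by auto
  have N: "N = m * n" using arg_cong[OF eq, of dim_row] B by (simp add: kronecker_def)
  have n: "n \<le> m * n" using m by (cases m) auto
  show "B $$ (i, j) = (c \<cdot>\<^sub>m 1\<^sub>m n) $$ (i, j)"
    using arg_cong[OF eq, of "\<lambda>M. M $$ (i, j)"] B ij n m N by (simp add: kronecker_def)
qed (use B in auto)

text \<open>Scalars preserve every line, and for n > 1 the line through the first basis vector is a
  proper nonzero subspace.\<close>

lemma irreducible_scalar_dim:
  assumes irr: "irreducible_representation G n \<sigma>"
    and scalar: "\<And>g. g \<in> carrier G \<Longrightarrow> \<exists>c. \<sigma> g = c \<cdot>\<^sub>m 1\<^sub>m n"
  shows "n = 1"
proof (rule ccontr)
  assume "n \<noteq> 1"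
  with irr have n: "1 < n" unfolding irreducible_representation_def by auto
  define W where "W = range (\<lambda>c :: complex. c \<cdot>\<^sub>v unit_vec n 0)"
  have "VectorSpace.subspace class_ring W (module_vec TYPE(complex) n)"
    unfolding VectorSpace.subspace_def submodule_def
  proof (intro conjI vec_vs vec_module ballI impI allI)
    show "W \<subseteq> carrier (module_vec TYPE(complex) n)" by (auto simp: W_def module_vec_simps)
    show "\<zero>\<^bsub>module_vec TYPE(complex) n\<^esub> \<in> W"
      unfolding W_def module_vec_simps by (intro range_eqI[of _ _ 0]) auto
    fix v w assume "v \<in> W" "w \<in> W"
    thus "v \<oplus>\<^bsub>module_vec TYPE(complex) n\<^esub> w \<in> W"
      unfolding W_def module_vec_simps by (auto simp: add_smult_distrib_vec[symmetric])
  next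
    fix c v assume "v \<in> W"
    thus "c \<odot>\<^bsub>module_vec TYPE(complex) n\<^esub> v \<in> W"
      unfolding W_def module_vec_simps by (auto simp: smult_smult_assoc)
  qed
  moreover have "\<sigma> g *\<^sub>v v \<in> W" if g: "g \<in> carrier G" and v: "v \<in> W" for g v
  proof -
    obtain c a where c: "\<sigma> g = c \<cdot>\<^sub>m 1\<^sub>m n" and v: "v = a \<cdot>\<^sub>v unit_vec n 0"
      using scalar[OF g] v unfolding W_def by auto
    have "\<sigma> g *\<^sub>v v = (c * a) \<cdot>\<^sub>v unit_vec n 0"
      unfolding c v by (rule eq_vecI) auto
    thus ?thesis by (auto simp: W_def)
  qed
  ultimately consider "W = {0\<^sub>v n}" | "W = carrier_vec n"
    using irr unfolding irreducible_representation_def by blast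
  thus False
  proof cases
    case 1
    have "unit_vec n 0 \<in> W" unfolding W_def by (intro range_eqI[of _ _ 1]) auto
    with 1 have "unit_vec n 0 $ 0 = (0\<^sub>v n $ 0 :: complex)" by simp
    thus False using n by simp
  next
    case 2
    hence "unit_vec n 1 \<in> W" by simp
    then obtain c where c: "unit_vec n 1 = (c \<cdot>\<^sub>v unit_vec n 0 :: complex vec)" by (auto simp: W_def)
    show False using arg_cong[OF c, of "\<lambda>v :: complex Matrix.vec. v $ 1"] n by simp
  qed
qed

subsection \<open>The bound $N(d)$\<close>

text \<open>A nonzero number has some bit set. Finiteness of the set of bits has to be shown as
  well, because \<open>card\<close> of an infinite set is 0.\<close>

lemma binary_ones_pos:
  assumes "0 < n"
  shows "1 \<le> binary_ones n"
proof -
  \<comment> \<open>A set bit at a position i with n \<le> i is impossible, as n \<le> i <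
    \<open>2 ^ i\<close> makes the quotient by \<open>2 ^ i\<close> vanish.\<close>
  have "i < n" if bit: "bit n i" for i
  proof (rule ccontr)
    assume "\<not> i < n"
    hence "n \<le> i" by (rule leI)
    also have "i < 2 ^ i" by (rule less_exp)
    finally have "n div 2 ^ i = 0" by (rule div_less)
    with bit show False unfolding bit_iff_odd by (simp only: even_zero not_True_eq_False)
  qed
  hence "{i. bit n i} \<subseteq> {..<n}" by blast
  hence fin: "finite {i. bit n i}" by (rule finite_subset) simp
  have "{i. bit n i} \<noteq> {}"
  proof
    assume "{i. bit n i} = {}"
    hence "n = 0" by (intro bit_eqI) auto
    with assms show False by simp
  qed
  with fin have "0 < binary_ones n"
    unfolding binary_ones_def by (simp add: card_gt_0_iff)
  thus ?thesis by simp
qed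

text \<open>Here 2 D = 4 d - 4, which is at most the square of d because the square of d - 2 is
  nonnegative. The corrections +2 and +1 occur only for residues 3 and 2 modulo 4, which force at
  least 3 and 2 binary ones; so subtracting twice the number of ones always outweighs them.\<close>

lemma N_bound_less:
  assumes "1 < d"
  shows "N_bound d < int (d\<^sup>2)"
proof -
  have sq: "4 * int d - 4 \<le> int (d\<^sup>2)"
    using zero_le_power2[of "int d - 2"] by (simp add: power2_eq_square algebra_simps)
  define a where "a = binary_ones (d - 1)"
  have "1 \<le> a" using assms unfolding a_def by (intro binary_ones_pos) simp
  moreover have "3 \<le> a" if "a mod 4 = 3" using that mod_less_eq_dividend[of a 4] by linarith
  moreover have "2 \<le> a" if "a mod 4 = 2" using that mod_less_eq_dividend[of a 4] by linarith
  ultimately have "N_bound d < 4 * int d - 4"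
    unfolding N_bound_def Let_def a_def[symmetric] by (simp split: if_splits) linarith
  thus ?thesis using sq by linarith
qed

subsection \<open>Entrywise integrals of matrix-valued functions\<close>

definition mat_integral :: "'g measure \<Rightarrow> nat \<Rightarrow> ('g \<Rightarrow> complex mat) \<Rightarrow> complex mat" where
  "mat_integral M d F = mat d d (\<lambda>(i, j). LINT g|M. F g $$ (i, j))"

text \<open>Dimensions are part of the notion, because the entry formula for products needs them and
  the type of \<open>F\<close> does not fix them.\<close>

definition mat_integrable :: "'g measure \<Rightarrow> nat \<Rightarrow> ('g \<Rightarrow> complex mat) \<Rightarrow> bool" where
  "mat_integrable M d F \<longleftrightarrow>
     (\<forall>g\<in>space M. F g \<in> carrier_mat d d) \<and> (\<forall>i<d. \<forall>j<d. integrable M (\<lambda>g. F g $$ (i, j)))"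

lemma mat_integral_carrier [simp]: "mat_integral M d F \<in> carrier_mat d d"
  unfolding mat_integral_def by simp

lemma mat_integral_cong:
  "(\<And>g. g \<in> space M \<Longrightarrow> F g = F' g) \<Longrightarrow> mat_integral M d F = mat_integral M d F'"
  unfolding mat_integral_def by (intro eq_matI) (auto intro!: Bochner_Integration.integral_cong)

lemma mat_integral_mult_left:
  assumes F: "mat_integrable M d F" and C: "C \<in> carrier_mat d d"
  shows "C * mat_integral M d F = mat_integral M d (\<lambda>g. C * F g)"
proof (rule eq_matI)
  fix i j assume "i < dim_row (mat_integral M d (\<lambda>g. C * F g))" "j < dim_col (mat_integral M d (\<lambda>g. C * F g))"
  hence ij: "i < d" "j < d" by (auto simp: mat_integral_def)
  have "(C * mat_integral M d F) $$ (i, j) = (\<Sum>l<d. C $$ (i, l) * (LINT g|M. F g $$ (l, j)))"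
    unfolding mat_mult_entry[OF C mat_integral_carrier ij] using ij by (simp add: mat_integral_def)
  also have "\<dots> = (LINT g|M. (\<Sum>l<d. C $$ (i, l) * F g $$ (l, j)))"
    using F ij unfolding mat_integrable_def by (subst Bochner_Integration.integral_sum) auto
  also have "\<dots> = (LINT g|M. (C * F g) $$ (i, j))"
    using F unfolding mat_integrable_def
    by (intro Bochner_Integration.integral_cong refl mat_mult_entry[OF C _ ij, symmetric]) auto
  finally show "(C * mat_integral M d F) $$ (i, j) = mat_integral M d (\<lambda>g. C * F g) $$ (i, j)"
    using ij by (simp add: mat_integral_def)
qed (use C in \<open>auto simp: mat_integral_def\<close>)

lemma mat_integral_mult_right:
  assumes F: "mat_integrable M d F" and C: "C \<in> carrier_mat d d"
  shows "mat_integral M d F * C = mat_integral M d (\<lambda>g. F g * C)"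
proof (rule eq_matI)
  fix i j assume "i < dim_row (mat_integral M d (\<lambda>g. F g * C))" "j < dim_col (mat_integral M d (\<lambda>g. F g * C))"
  hence ij: "i < d" "j < d" by (auto simp: mat_integral_def)
  have "(mat_integral M d F * C) $$ (i, j) = (\<Sum>l<d. (LINT g|M. F g $$ (i, l)) * C $$ (l, j))"
    unfolding mat_mult_entry[OF mat_integral_carrier C ij] using ij by (simp add: mat_integral_def)
  also have "\<dots> = (LINT g|M. (\<Sum>l<d. F g $$ (i, l) * C $$ (l, j)))"
    using F ij unfolding mat_integrable_def by (subst Bochner_Integration.integral_sum) auto
  also have "\<dots> = (LINT g|M. (F g * C) $$ (i, j))"
    using F unfolding mat_integrable_def
    by (intro Bochner_Integration.integral_cong refl mat_mult_entry[OF _ C ij, symmetric]) auto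
  finally show "(mat_integral M d F * C) $$ (i, j) = mat_integral M d (\<lambda>g. F g * C) $$ (i, j)"
    using ij by (simp add: mat_integral_def)
qed (use C in \<open>auto simp: mat_integral_def\<close>)

lemma mat_integrable_mult_left:
  assumes F: "mat_integrable M d F" and C: "C \<in> carrier_mat d d"
  shows "mat_integrable M d (\<lambda>g. C * F g)"
  unfolding mat_integrable_def
proof (intro conjI ballI allI impI)
  fix i j assume ij: "i < d" "j < d"
  have "integrable M (\<lambda>g. \<Sum>l<d. C $$ (i, l) * F g $$ (l, j))"
    using F ij unfolding mat_integrable_def by auto
  thus "integrable M (\<lambda>g. (C * F g) $$ (i, j))"
    using F unfolding mat_integrable_def
    by (subst Bochner_Integration.integrable_cong[OF refl mat_mult_entry[OF C _ ij]]) auto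
qed (use F C in \<open>auto simp: mat_integrable_def\<close>)

lemma mat_trace_integral:
  assumes F: "mat_integrable M d F"
  shows "mat_trace (mat_integral M d F) = (LINT g|M. mat_trace (F g))"
proof -
  have "mat_trace (mat_integral M d F) = (LINT g|M. (\<Sum>i<d. F g $$ (i, i)))"
    using F unfolding mat_integrable_def mat_trace_def
    by (subst Bochner_Integration.integral_sum) (auto simp: mat_integral_def)
  also have "\<dots> = (LINT g|M. mat_trace (F g))"
    using F unfolding mat_integrable_def mat_trace_def
    by (intro Bochner_Integration.integral_cong) auto
  finally show ?thesis .
qed

lemma mat_adjoint_integral:
  assumes F: "mat_integrable M d F"
  shows "mat_adjoint (mat_integral M d F) = mat_integral M d (\<lambda>g. mat_adjoint (F g))"
proof (rule eq_matI)
  fix i j assume "i < dim_row (mat_integral M d (\<lambda>g. mat_adjoint (F g)))"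
    "j < dim_col (mat_integral M d (\<lambda>g. mat_adjoint (F g)))"
  hence ij: "i < d" "j < d" by (auto simp: mat_integral_def)
  have "mat_adjoint (mat_integral M d F) $$ (i, j) = (LINT g|M. cnj (F g $$ (j, i)))"
    unfolding mat_adjoint_entry[OF mat_integral_carrier ij] using ij by (simp add: mat_integral_def)
  also have "\<dots> = (LINT g|M. mat_adjoint (F g) $$ (i, j))"
    using F unfolding mat_integrable_def
    by (intro Bochner_Integration.integral_cong refl mat_adjoint_entry[OF _ ij, symmetric]) auto
  finally show "mat_adjoint (mat_integral M d F) $$ (i, j) = mat_integral M d (\<lambda>g. mat_adjoint (F g)) $$ (i, j)"
    using ij by (simp add: mat_integral_def)
qed (auto simp: mat_integral_def)

subsection \<open>The twirling channel\<close>

locale haar_representation =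
  fixes G :: "('g, 'b) monoid_scheme" and T :: "'g topology" and \<mu> :: "'g measure"
    and d :: nat and \<pi> :: "'g \<Rightarrow> complex mat"
  assumes compact_group: "compact_group G T"
    and haar: "normalized_haar_measure G T \<mu>"
    and rep: "unitary_representation G T d \<pi>"
begin

sublocale group G
  using compact_group unfolding compact_group_def by simp

lemma topspace: "topspace T = carrier G"
  using compact_group unfolding compact_group_def by simp

section \<open>Borel sets of the group and left translation of integrals\<close>

lemma sets_haar: "sets \<mu> = sigma_sets (carrier G) {V. openin T V}"
  and space_haar: "space \<mu> = carrier G"
proof -
  have sub: "{V. openin T V} \<subseteq> Pow (topspace T)" by (auto dest: openin_subset)
  have s: "sets \<mu> = sets (sigma (topspace T) {V. openin T V})"
    using haar unfolding normalized_haar_measure_def by simp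
  show "sets \<mu> = sigma_sets (carrier G) {V. openin T V}"
    using s sub by (simp add: topspace)
  show "space \<mu> = carrier G"
    using sets_eq_imp_space_eq[OF s] sub by (simp add: topspace)
qed

lemma emeasure_haar: "emeasure \<mu> (space \<mu>) = 1"
  using haar unfolding normalized_haar_measure_def by simp

sublocale haar: finite_measure \<mu>
  by (rule finite_measureI) (simp add: emeasure_haar)

text \<open>\<open>T\<close> is a topology as a value, not a type class instance, so preimages of
  open sets are traced back to the generators of the sigma-algebra.\<close>

lemma continuous_measurable:
  fixes f :: "'g \<Rightarrow> complex"
  assumes "continuous_map T euclidean f"
  shows "f \<in> borel_measurable \<mu>"
proof (rule borel_measurableI)
  fix S :: "complex set" assume "open S"
  hence "openin T {x \<in> topspace T. f x \<in> S}"
    using assms by (intro openin_continuous_map_preimage) auto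
  moreover have "f -` S \<inter> space \<mu> = {x \<in> topspace T. f x \<in> S}"
    by (auto simp: space_haar topspace)
  ultimately show "f -` S \<inter> space \<mu> \<in> sets \<mu>" by (auto simp: sets_haar)
qed

lemma translation_measurable:
  assumes h: "h \<in> carrier G"
  shows "(\<lambda>g. h \<otimes>\<^bsub>G\<^esub> g) \<in> measurable \<mu> \<mu>"
proof (rule measurable_sigma_sets[OF sets_haar])
  have "continuous_map T T ((\<lambda>(g, h). g \<otimes>\<^bsub>G\<^esub> h) \<circ> (\<lambda>g. (h, g)))"
    using compact_group h topspace unfolding compact_group_def
    by (intro continuous_map_compose[of _ "prod_topology T T"]) (auto simp: continuous_map_paired)
  hence cont: "continuous_map T T (\<lambda>g. h \<otimes>\<^bsub>G\<^esub> g)" by (simp add: o_def)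
  fix V assume "V \<in> {V. openin T V}"
  hence "openin T {x \<in> topspace T. h \<otimes>\<^bsub>G\<^esub> x \<in> V}"
    using cont by (intro openin_continuous_map_preimage) auto
  moreover have "(\<lambda>g. h \<otimes>\<^bsub>G\<^esub> g) -` V \<inter> space \<mu> = {x \<in> topspace T. h \<otimes>\<^bsub>G\<^esub> x \<in> V}"
    by (auto simp: space_haar topspace)
  ultimately show "(\<lambda>g. h \<otimes>\<^bsub>G\<^esub> g) -` V \<inter> space \<mu> \<in> sets \<mu>" by (auto simp: sets_haar)
qed (use h in \<open>auto simp: space_haar topspace[symmetric] dest: openin_subset\<close>, auto simp: topspace)

text \<open>Left translation pushes \<mu> forward to itself, and integrals transform along with the
  measure.\<close>

lemma integral_translation:
  fixes f :: "'g \<Rightarrow> complex"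
  assumes h: "h \<in> carrier G" and f: "f \<in> borel_measurable \<mu>"
  shows "(LINT g|\<mu>. f (h \<otimes>\<^bsub>G\<^esub> g)) = (LINT g|\<mu>. f g)"
proof -
  have "distr \<mu> \<mu> (\<lambda>g. h \<otimes>\<^bsub>G\<^esub> g) = \<mu>"
  proof (rule measure_eqI)
    fix A assume "A \<in> sets (distr \<mu> \<mu> (\<lambda>g. h \<otimes>\<^bsub>G\<^esub> g))"
    hence A: "A \<in> sets \<mu>" by simp
    hence sub: "A \<subseteq> carrier G" using sets.sets_into_space space_haar by auto
    \<comment> \<open>Turns the preimage into a left coset, the form in which invariance of \<mu> is
      assumed.\<close>
    have "(\<lambda>g. h \<otimes>\<^bsub>G\<^esub> g) -` A \<inter> space \<mu> = inv\<^bsub>G\<^esub> h <#\<^bsub>G\<^esub> A"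
    proof (intro equalityI subsetI)
      fix g assume g: "g \<in> (\<lambda>g. h \<otimes>\<^bsub>G\<^esub> g) -` A \<inter> space \<mu>"
      hence "g = inv\<^bsub>G\<^esub> h \<otimes>\<^bsub>G\<^esub> (h \<otimes>\<^bsub>G\<^esub> g)"
        using h by (simp add: space_haar inv_solve_left)
      thus "g \<in> inv\<^bsub>G\<^esub> h <#\<^bsub>G\<^esub> A" using g by (auto simp: l_coset_def)
    next
      fix g assume "g \<in> inv\<^bsub>G\<^esub> h <#\<^bsub>G\<^esub> A"
      then obtain a where "a \<in> A" "g = inv\<^bsub>G\<^esub> h \<otimes>\<^bsub>G\<^esub> a" by (auto simp: l_coset_def)
      moreover have "a \<in> carrier G" using sub \<open>a \<in> A\<close> by auto
      moreover have "h \<otimes>\<^bsub>G\<^esub> (inv\<^bsub>G\<^esub> h \<otimes>\<^bsub>G\<^esub> a) = a"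
        using h \<open>a \<in> carrier G\<close> by (simp add: m_assoc[symmetric])
      ultimately show "g \<in> (\<lambda>g. h \<otimes>\<^bsub>G\<^esub> g) -` A \<inter> space \<mu>"
        using h by (auto simp: space_haar)
    qed
    hence "emeasure (distr \<mu> \<mu> (\<lambda>g. h \<otimes>\<^bsub>G\<^esub> g)) A = emeasure \<mu> (inv\<^bsub>G\<^esub> h <#\<^bsub>G\<^esub> A)"
      using A by (simp add: emeasure_distr translation_measurable[OF h])
    also have "\<dots> = emeasure \<mu> A"
      using haar A h unfolding normalized_haar_measure_def by simp
    finally show "emeasure (distr \<mu> \<mu> (\<lambda>g. h \<otimes>\<^bsub>G\<^esub> g)) A = emeasure \<mu> A" .
  qed simp
  thus ?thesis using integral_distr[OF translation_measurable[OF h] f] by simp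
qed

section \<open>Algebra, measurability and boundedness of the representation\<close>

lemma rep_unitary: "g \<in> carrier G \<Longrightarrow> unitary_mat d (\<pi> g)"
  using rep unfolding unitary_representation_def by simp

lemma rep_carrier: "g \<in> carrier G \<Longrightarrow> \<pi> g \<in> carrier_mat d d"
  using rep_unitary unfolding unitary_mat_def by simp

lemma rep_mult: "g \<in> carrier G \<Longrightarrow> h \<in> carrier G \<Longrightarrow> \<pi> (g \<otimes>\<^bsub>G\<^esub> h) = \<pi> g * \<pi> h"
  using rep unfolding unitary_representation_def by simp

text \<open>Multiplicativity makes \<pi>(1) idempotent, and an invertible idempotent is the
  identity.\<close>

lemma rep_one: "\<pi> \<one>\<^bsub>G\<^esub> = 1\<^sub>m d"
proof -
  let ?E = "\<pi> \<one>\<^bsub>G\<^esub>"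
  have c: "?E \<in> carrier_mat d d" and u: "mat_adjoint ?E * ?E = 1\<^sub>m d"
    using rep_unitary[of "\<one>\<^bsub>G\<^esub>"] unfolding unitary_mat_def by auto
  have "?E = (mat_adjoint ?E * ?E) * ?E" using c u by simp
  also have "\<dots> = mat_adjoint ?E * (?E * ?E)" using c by (intro assoc_mult_mat) auto
  also have "?E * ?E = ?E" using rep_mult[of "\<one>\<^bsub>G\<^esub>" "\<one>\<^bsub>G\<^esub>"] by simp
  finally show ?thesis using u by simp
qed

lemma rep_inv_left: "g \<in> carrier G \<Longrightarrow> \<pi> (inv\<^bsub>G\<^esub> g) * \<pi> g = 1\<^sub>m d"
  using rep_mult[of "inv\<^bsub>G\<^esub> g" g] by (simp add: rep_one)

lemma rep_inv_right: "g \<in> carrier G \<Longrightarrow> \<pi> g * \<pi> (inv\<^bsub>G\<^esub> g) = 1\<^sub>m d"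
  using rep_mult[of g "inv\<^bsub>G\<^esub> g"] by (simp add: rep_one)

lemma rep_adjoint:
  assumes g: "g \<in> carrier G"
  shows "mat_adjoint (\<pi> g) = \<pi> (inv\<^bsub>G\<^esub> g)"
proof -
  have c: "\<pi> g \<in> carrier_mat d d" "mat_adjoint (\<pi> g) \<in> carrier_mat d d" "\<pi> (inv\<^bsub>G\<^esub> g) \<in> carrier_mat d d"
    and u: "mat_adjoint (\<pi> g) * \<pi> g = 1\<^sub>m d"
    using rep_unitary[OF g] g rep_carrier unfolding unitary_mat_def by auto
  have "mat_adjoint (\<pi> g) = mat_adjoint (\<pi> g) * (\<pi> g * \<pi> (inv\<^bsub>G\<^esub> g))"
    using c g by (simp add: rep_inv_right)
  also have "\<dots> = mat_adjoint (\<pi> g) * \<pi> g * \<pi> (inv\<^bsub>G\<^esub> g)"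
    using c by (intro assoc_mult_mat[symmetric]) auto
  finally show ?thesis using c u by simp
qed

lemma rep_entry_measurable:
  "i < d \<Longrightarrow> j < d \<Longrightarrow> (\<lambda>g. \<pi> g $$ (i, j)) \<in> borel_measurable \<mu>"
  "i < d \<Longrightarrow> j < d \<Longrightarrow> (\<lambda>g. \<pi> (inv\<^bsub>G\<^esub> g) $$ (i, j)) \<in> borel_measurable \<mu>"
proof -
  assume ij: "i < d" "j < d"
  hence c: "continuous_map T euclidean (\<lambda>g. \<pi> g $$ (i, j))"
    using rep unfolding unitary_representation_def by simp
  thus "(\<lambda>g. \<pi> g $$ (i, j)) \<in> borel_measurable \<mu>" by (rule continuous_measurable)
  have "continuous_map T T (\<lambda>g. inv\<^bsub>G\<^esub> g)"
    using compact_group unfolding compact_group_def by simp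
  from continuous_map_compose[OF this c]
  show "(\<lambda>g. \<pi> (inv\<^bsub>G\<^esub> g) $$ (i, j)) \<in> borel_measurable \<mu>"
    by (intro continuous_measurable) (simp add: o_def)
qed

lemma rep_entry_le_1: "g \<in> carrier G \<Longrightarrow> i < d \<Longrightarrow> j < d \<Longrightarrow> cmod (\<pi> g $$ (i, j)) \<le> 1"
  by (rule unitary_entry_le_1[OF rep_unitary])

text \<open>Entries are finite sums of bounded measurable functions on a finite measure space. The
  general factors \<open>P\<close> and \<open>Q\<close> serve both the integrand of the channel and
  that of its adjoint.\<close>

lemma sandwich_integrable:
  assumes X: "X \<in> carrier_mat d d"
    and PQ: "\<And>g. g \<in> carrier G \<Longrightarrow> P g \<in> carrier_mat d d \<and> Q g \<in> carrier_mat d d"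
    and meas: "\<And>i j. i < d \<Longrightarrow> j < d \<Longrightarrow> (\<lambda>g. P g $$ (i, j)) \<in> borel_measurable \<mu>"
      "\<And>i j. i < d \<Longrightarrow> j < d \<Longrightarrow> (\<lambda>g. Q g $$ (i, j)) \<in> borel_measurable \<mu>"
    and bound: "\<And>g i j. g \<in> carrier G \<Longrightarrow> i < d \<Longrightarrow> j < d \<Longrightarrow> cmod (P g $$ (i, j)) \<le> 1"
      "\<And>g i j. g \<in> carrier G \<Longrightarrow> i < d \<Longrightarrow> j < d \<Longrightarrow> cmod (Q g $$ (i, j)) \<le> 1"
  shows "mat_integrable \<mu> d (\<lambda>g. P g * X * Q g)"
  unfolding mat_integrable_def
proof (intro conjI ballI allI impI)
  fix i j assume ij: "i < d" "j < d"
  have "integrable \<mu> (\<lambda>g. P g $$ (i, k) * X $$ (k, l) * Q g $$ (l, j))" if kl: "k < d" "l < d" for k l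
  proof (rule haar.integrable_const_bound[where B = "cmod (X $$ (k, l))"])
    show "(\<lambda>g. P g $$ (i, k) * X $$ (k, l) * Q g $$ (l, j)) \<in> borel_measurable \<mu>"
      using meas(1)[OF ij(1) kl(1)] meas(2)[OF kl(2) ij(2)] by measurable
    show "AE g in \<mu>. cmod (P g $$ (i, k) * X $$ (k, l) * Q g $$ (l, j)) \<le> cmod (X $$ (k, l))"
    proof (rule AE_I2)
      fix g assume "g \<in> space \<mu>"
      hence g: "g \<in> carrier G" by (simp add: space_haar)
      have "cmod (P g $$ (i, k)) * cmod (X $$ (k, l)) * cmod (Q g $$ (l, j)) \<le> 1 * cmod (X $$ (k, l)) * 1"
        using bound(1)[OF g ij(1) kl(1)] bound(2)[OF g kl(2) ij(2)] by (intro mult_mono) auto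
      thus "cmod (P g $$ (i, k) * X $$ (k, l) * Q g $$ (l, j)) \<le> cmod (X $$ (k, l))"
        by (simp add: norm_mult)
    qed
  qed
  hence "integrable \<mu> (\<lambda>g. \<Sum>l<d. \<Sum>k<d. P g $$ (i, k) * X $$ (k, l) * Q g $$ (l, j))"
    by (intro Bochner_Integration.integrable_sum) auto
  thus "integrable \<mu> (\<lambda>g. (P g * X * Q g) $$ (i, j))"
    using PQ X ij
    by (subst Bochner_Integration.integrable_cong[OF refl mat_mult3_entry]) (auto simp: space_haar)
next
  fix g assume "g \<in> space \<mu>"
  thus "P g * X * Q g \<in> carrier_mat d d" using PQ[of g] X by (auto simp: space_haar)
qed

lemma conj_integrable:
  assumes "X \<in> carrier_mat d d"
  shows "mat_integrable \<mu> d (\<lambda>g. \<pi> g * X * \<pi> (inv\<^bsub>G\<^esub> g))"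
    "mat_integrable \<mu> d (\<lambda>g. \<pi> (inv\<^bsub>G\<^esub> g) * X * \<pi> g)"
  using assms by (intro sandwich_integrable; simp add: rep_carrier rep_entry_measurable rep_entry_le_1)+

section \<open>The twirl as orthogonal projection onto the commutant\<close>

abbreviation twirl :: "complex mat \<Rightarrow> complex mat" where
  "twirl \<equiv> twirling_channel G \<mu> d \<pi>"

lemma twirl_eq: "twirl X = mat_integral \<mu> d (\<lambda>g. \<pi> g * X * \<pi> (inv\<^bsub>G\<^esub> g))"
  unfolding twirling_channel_def mat_integral_def ..

lemma twirl_carrier [simp]: "twirl X \<in> carrier_mat d d"
  unfolding twirl_eq by simp

definition commutant :: "complex mat set" where
  "commutant = {C \<in> carrier_mat d d. \<forall>g\<in>carrier G. \<pi> g * C = C * \<pi> g}"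

text \<open>Take adjoints in the commutation relation at the inverse of g, where the adjoint of
  \<open>\<pi> (inv g)\<close> is \<open>\<pi> g\<close>.\<close>

lemma commutant_adjoint:
  assumes "C \<in> commutant"
  shows "mat_adjoint C \<in> commutant"
proof -
  have C: "C \<in> carrier_mat d d" using assms by (simp add: commutant_def)
  have "\<pi> g * mat_adjoint C = mat_adjoint C * \<pi> g" if g: "g \<in> carrier G" for g
  proof -
    let ?h = "inv\<^bsub>G\<^esub> g"
    have h: "?h \<in> carrier G" using g by simp
    have "mat_adjoint (C * \<pi> ?h) = mat_adjoint (\<pi> ?h * C)"
      using assms h by (simp add: commutant_def)
    thus ?thesis
      using C g rep_adjoint[OF h] rep_carrier[OF h] by (simp add: mat_adjoint_mult[of _ d d _ d])
  qed
  thus ?thesis using C by (simp add: commutant_def)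
qed

lemma commutant_minus:
  assumes "C \<in> commutant" "D \<in> commutant"
  shows "C - D \<in> commutant"
proof -
  have C: "C \<in> carrier_mat d d" "D \<in> carrier_mat d d" using assms by (auto simp: commutant_def)
  have "\<pi> g * (C - D) = (C - D) * \<pi> g" if g: "g \<in> carrier G" for g
    using assms g C rep_carrier[OF g] by (simp add: mult_minus_distrib_mat[of _ d d _ d] minus_mult_distrib_mat[of _ d d _ _ d] commutant_def)
  thus ?thesis using C by (simp add: commutant_def minus_carrier_mat)
qed

text \<open>Replacing g by h g conjugates the integrand by \<pi>(h) and leaves the integral
  unchanged, so the twirl equals its own conjugate.\<close>

lemma twirl_in_commutant:
  assumes X: "X \<in> carrier_mat d d"
  shows "twirl X \<in> commutant"
proof -
  have "\<pi> h * twirl X = twirl X * \<pi> h" if h: "h \<in> carrier G" for h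
  proof -
    let ?F = "\<lambda>g. \<pi> g * X * \<pi> (inv\<^bsub>G\<^esub> g)"
    have tr: "?F (h \<otimes>\<^bsub>G\<^esub> g) = \<pi> h * ?F g * \<pi> (inv\<^bsub>G\<^esub> h)" if g: "g \<in> carrier G" for g
    proof -
      note [simp] = rep_carrier[OF g] rep_carrier[OF h] rep_carrier[OF inv_closed[OF g]]
        rep_carrier[OF inv_closed[OF h]] X
      have "?F (h \<otimes>\<^bsub>G\<^esub> g) = (\<pi> h * \<pi> g) * X * (\<pi> (inv\<^bsub>G\<^esub> g) * \<pi> (inv\<^bsub>G\<^esub> h))"
        using g h by (simp add: rep_mult inv_mult_group)
      also have "\<dots> = \<pi> h * ?F g * \<pi> (inv\<^bsub>G\<^esub> h)"
        by (simp add: assoc_mult_mat[of _ d d _ d _ d] mult_carrier_mat[of _ d d _ d])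
      finally show ?thesis .
    qed
    have "twirl X = mat_integral \<mu> d (\<lambda>g. ?F (h \<otimes>\<^bsub>G\<^esub> g))"
      unfolding twirl_eq mat_integral_def
      using conj_integrable(1)[OF X] unfolding mat_integrable_def
      by (intro eq_matI) (auto intro!: integral_translation[OF h, symmetric] borel_measurable_integrable)
    also have "\<dots> = mat_integral \<mu> d (\<lambda>g. \<pi> h * ?F g * \<pi> (inv\<^bsub>G\<^esub> h))"
      by (intro mat_integral_cong tr) (simp add: space_haar)
    also have "\<dots> = \<pi> h * twirl X * \<pi> (inv\<^bsub>G\<^esub> h)"
      unfolding twirl_eq using conj_integrable(1)[OF X] rep_carrier[OF h] rep_carrier[OF inv_closed[OF h]]
      by (simp add: mat_integral_mult_left mat_integral_mult_right mat_integrable_mult_left)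
    finally have "twirl X * \<pi> h = \<pi> h * twirl X * \<pi> (inv\<^bsub>G\<^esub> h) * \<pi> h" by simp
    also have "\<dots> = \<pi> h * twirl X * (\<pi> (inv\<^bsub>G\<^esub> h) * \<pi> h)"
      using h by (intro assoc_mult_mat[of _ d d _ d _ d]) (auto simp: rep_carrier mult_carrier_mat[of _ d d _ d])
    also have "\<dots> = \<pi> h * twirl X"
      unfolding rep_inv_left[OF h]
      by (rule right_mult_one_mat[OF mult_carrier_mat[OF rep_carrier[OF h] twirl_carrier]])
    finally show ?thesis by simp
  qed
  thus ?thesis by (simp add: commutant_def)
qed

lemma mat_trace_conj:
  assumes "g \<in> carrier G" "X \<in> carrier_mat d d"
  shows "mat_trace (\<pi> g * X * \<pi> (inv\<^bsub>G\<^esub> g)) = mat_trace X"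
proof -
  note c = rep_carrier[OF assms(1)] rep_carrier[OF inv_closed[OF assms(1)]]
  have "mat_trace (\<pi> g * X * \<pi> (inv\<^bsub>G\<^esub> g)) = mat_trace (\<pi> (inv\<^bsub>G\<^esub> g) * (\<pi> g * X))"
    using assms c by (intro mat_trace_comm[of _ d d]) (auto simp: mult_carrier_mat[of _ d d _ d])
  also have "\<pi> (inv\<^bsub>G\<^esub> g) * (\<pi> g * X) = \<pi> (inv\<^bsub>G\<^esub> g) * \<pi> g * X"
    using assms c by (intro assoc_mult_mat[symmetric]) auto
  finally show ?thesis using assms by (simp add: rep_inv_left)
qed

text \<open>C slides past \<pi>(g), after which cyclicity of the trace removes the
  conjugation.\<close>

lemma mat_trace_commutant_conj:
  assumes C: "C \<in> commutant" and X: "X \<in> carrier_mat d d" and g: "g \<in> carrier G"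
  shows "mat_trace (C * (\<pi> g * X * \<pi> (inv\<^bsub>G\<^esub> g))) = mat_trace (C * X)"
proof -
  note c = rep_carrier[OF g] rep_carrier[OF inv_closed[OF g]]
  have Cc: "C \<in> carrier_mat d d" and comm: "C * \<pi> g = \<pi> g * C" using C g by (auto simp: commutant_def)
  have "C * (\<pi> g * X * \<pi> (inv\<^bsub>G\<^esub> g)) = C * \<pi> g * X * \<pi> (inv\<^bsub>G\<^esub> g)"
    using Cc c X by (simp add: assoc_mult_mat[of _ d d _ d _ d] mult_carrier_mat[of _ d d _ d])
  also have "\<dots> = \<pi> g * (C * X) * \<pi> (inv\<^bsub>G\<^esub> g)"
    unfolding comm using Cc c X by (simp add: assoc_mult_mat[of _ d d _ d _ d] mult_carrier_mat[of _ d d _ d])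
  finally show ?thesis using Cc X g by (simp add: mat_trace_conj)
qed

text \<open>The integrand is constant in g and \<mu> has mass 1. As the commutant is closed under
  adjoints, \<open>twirl X - X\<close> is orthogonal to it.\<close>

lemma mat_trace_commutant_twirl:
  assumes C: "C \<in> commutant" and X: "X \<in> carrier_mat d d"
  shows "mat_trace (C * twirl X) = mat_trace (C * X)"
proof -
  have Cc: "C \<in> carrier_mat d d" using C by (auto simp: commutant_def)
  have "mat_trace (C * twirl X) = (LINT g|\<mu>. mat_trace (C * (\<pi> g * X * \<pi> (inv\<^bsub>G\<^esub> g))))"
    unfolding twirl_eq
    by (simp add: Cc X conj_integrable mat_integral_mult_left mat_trace_integral mat_integrable_mult_left)
  also have "\<dots> = (LINT g|\<mu>. mat_trace (C * X))"
    by (intro Bochner_Integration.integral_cong refl mat_trace_commutant_conj[OF C X]) (simp add: space_haar)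
  finally show ?thesis by (simp add: measure_def emeasure_haar)
qed

text \<open>
  Only left invariance of \<open>\<mu>\<close> is available, so the substitution \<open>g \<mapsto> g h\<close> cannot be used here. Instead,
  the difference \<open>D\<close> of the two sides lies in the commutant and is Hilbert--Schmidt orthogonal to the
  commutant, hence to itself.
\<close>

lemma twirl_conj:
  assumes X: "X \<in> carrier_mat d d" and h: "h \<in> carrier G"
  shows "twirl (\<pi> h * X * \<pi> (inv\<^bsub>G\<^esub> h)) = twirl X"
proof -
  define Y where "Y = \<pi> h * X * \<pi> (inv\<^bsub>G\<^esub> h)"
  define D where "D = twirl Y - twirl X"
  have Y: "Y \<in> carrier_mat d d"
    unfolding Y_def using X rep_carrier[OF h] rep_carrier[OF inv_closed[OF h]] by (simp add: mult_carrier_mat[of _ d d _ d])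
  have D: "D \<in> commutant" unfolding D_def using X Y by (intro commutant_minus twirl_in_commutant)
  hence Dc: "D \<in> carrier_mat d d" by (simp add: commutant_def)
  have "hs_inner D D = hs_inner D (twirl Y) - hs_inner D (twirl X)"
    by (subst (2) D_def, rule hs_inner_minus[OF Dc]) auto
  also have "\<dots> = mat_trace (mat_adjoint D * Y) - mat_trace (mat_adjoint D * X)"
    unfolding hs_inner_def using D X Y by (simp add: mat_trace_commutant_twirl commutant_adjoint)
  \<comment> \<open>\<open>Y\<close> is a conjugate of \<open>X\<close>, and an element of the
    commutant has the same trace against both.\<close>
  also have "\<dots> = 0"
    unfolding Y_def using D X h by (simp add: mat_trace_commutant_conj commutant_adjoint)
  finally have "D = 0\<^sub>m d d" by (rule hs_inner_self_eq_0[OF Dc])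
  hence D0: "D $$ (i, j) = 0" if "i < d" "j < d" for i j using that by simp
  have "twirl Y = twirl X"
    using D0 by (intro eq_matI) (auto simp: D_def carrier_matD[OF twirl_carrier])
  thus ?thesis by (simp add: Y_def)
qed

lemma hs_inner_adjoint_twirl:
  assumes X: "X \<in> carrier_mat d d" and B: "B \<in> carrier_mat d d"
  shows "hs_inner X (hs_adjoint d twirl B) = hs_inner (twirl X) B"
proof (rule hs_adjoint_inner[OF _ _ X])
  \<comment> \<open>The adjoint is found by moving the two outer factors around the trace under the
    integral. Keeping the inverse on the left avoids the substitution of g by its inverse, which
    would turn this integral into the twirl of \<open>B\<close>.\<close>
  define A where "A = mat_integral \<mu> d (\<lambda>g. \<pi> (inv\<^bsub>G\<^esub> g) * B * \<pi> g)"
  show "A \<in> carrier_mat d d" by (simp add: A_def)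
  fix X :: "complex mat" assume X: "X \<in> carrier_mat d d"
  let ?F = "\<lambda>g. \<pi> g * mat_adjoint X * \<pi> (inv\<^bsub>G\<^esub> g)"
  have Xa: "mat_adjoint X \<in> carrier_mat d d" using X by simp
  have adj: "mat_adjoint (\<pi> g * X * \<pi> (inv\<^bsub>G\<^esub> g)) = ?F g" if g: "g \<in> carrier G" for g
  proof -
    note c = rep_carrier[OF g] rep_carrier[OF inv_closed[OF g]]
    have "mat_adjoint (\<pi> g * X * \<pi> (inv\<^bsub>G\<^esub> g)) = \<pi> g * (mat_adjoint X * \<pi> (inv\<^bsub>G\<^esub> g))"
      using mat_adjoint_mult[OF mult_carrier_mat[OF c(1) X] c(2)] mat_adjoint_mult[OF c(1) X] g
      by (simp add: rep_adjoint)
    thus ?thesis using c Xa by (simp add: assoc_mult_mat[of _ d d _ d _ d] mult_carrier_mat[of _ d d _ d])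
  qed
  have "mat_adjoint (twirl X) = mat_integral \<mu> d ?F"
    unfolding twirl_eq mat_adjoint_integral[OF conj_integrable(1)[OF X]]
    by (intro mat_integral_cong adj) (simp add: space_haar)
  hence "hs_inner (twirl X) B = mat_trace (B * mat_integral \<mu> d ?F)"
    unfolding hs_inner_def using B by (simp add: mat_trace_comm[of _ d d])
  also have "\<dots> = (LINT g|\<mu>. mat_trace (B * ?F g))"
    by (simp add: B Xa conj_integrable mat_integral_mult_left mat_trace_integral mat_integrable_mult_left)
  also have "\<dots> = (LINT g|\<mu>. mat_trace (mat_adjoint X * (\<pi> (inv\<^bsub>G\<^esub> g) * B * \<pi> g)))"
  proof (intro Bochner_Integration.integral_cong refl)
    fix g assume "g \<in> space \<mu>"
    hence g: "g \<in> carrier G" by (simp add: space_haar)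
    note c = rep_carrier[OF g] rep_carrier[OF inv_closed[OF g]]
    have "mat_trace (B * ?F g) = mat_trace ((B * \<pi> g) * (mat_adjoint X * \<pi> (inv\<^bsub>G\<^esub> g)))"
      using c Xa B by (simp add: assoc_mult_mat[of _ d d _ d _ d] mult_carrier_mat[of _ d d _ d])
    also have "\<dots> = mat_trace ((mat_adjoint X * \<pi> (inv\<^bsub>G\<^esub> g)) * (B * \<pi> g))"
      using c Xa B by (intro mat_trace_comm[of _ d d]) auto
    finally show "mat_trace (B * ?F g) = mat_trace (mat_adjoint X * (\<pi> (inv\<^bsub>G\<^esub> g) * B * \<pi> g))"
      using c Xa B by (simp add: assoc_mult_mat[of _ d d _ d _ d] mult_carrier_mat[of _ d d _ d])
  qed
  also have "\<dots> = hs_inner X A"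
    unfolding hs_inner_def A_def
    by (simp add: B Xa conj_integrable mat_integral_mult_left mat_trace_integral mat_integrable_mult_left)
  finally show "hs_inner X A = hs_inner (twirl X) B" by simp
qed

text \<open>The states of x and \<pi>(h) x have the same twirl, hence the same statistics for any
  POVM; injectivity then makes \<pi>(h) fix every pure state.\<close>

lemma phase_retrievable_imp_scalar:
  assumes pr: "phase_retrievable d d twirl" and d: "0 < d" and h: "h \<in> carrier G"
  shows "\<exists>c. \<pi> h = c \<cdot>\<^sub>m 1\<^sub>m d"
proof (rule scalar_of_fixes_pure_states[OF rep_unitary[OF h] d])
  obtain N F where povm: "povm d N F" and inj: "\<And>x y. unit_vector d x \<Longrightarrow> unit_vector d y \<Longrightarrow>
      (\<And>j. j < N \<Longrightarrow> mat_trace (pure_state x * hs_adjoint d twirl (F j)) =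
        mat_trace (pure_state y * hs_adjoint d twirl (F j))) \<Longrightarrow> pure_state x = pure_state y"
    using pr unfolding phase_retrievable_def by blast
  fix x assume ux: "unit_vector d x"
  hence x: "x \<in> carrier_vec d" by (simp add: unit_vector_def)
  define y where "y = \<pi> h *\<^sub>v x"
  have y: "y \<in> carrier_vec d" unfolding y_def using x rep_carrier[OF h] by (intro mult_mat_vec_carrier[of _ d d])
  have \<rho>: "pure_state y = \<pi> h * pure_state x * \<pi> (inv\<^bsub>G\<^esub> h)"
    unfolding y_def using x h rep_carrier[OF h] by (simp add: pure_state_mult_mat_vec[of _ d] rep_adjoint)
  \<comment> \<open>The squared norm is the trace of the pure state, which conjugation
    preserves.\<close>
  have "y \<bullet>c y = x \<bullet>c x"
    using mat_trace_pure_state[OF y] mat_trace_pure_state[OF x] x h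
    by (simp add: \<rho> mat_trace_conj pure_state_carrier)
  hence uy: "unit_vector d y" using ux y by (simp add: unit_vector_def)
  have same_image: "twirl (pure_state y) = twirl (pure_state x)"
    unfolding \<rho> using x h by (simp add: twirl_conj pure_state_carrier)
  show "pure_state y = pure_state x"
  proof (rule inj[OF uy ux])
    fix j assume "j < N"
    hence F: "F j \<in> carrier_mat d d" using povm unfolding povm_def psd_mat_def by simp
    \<comment> \<open>Pure states are self-adjoint, so this trace is a Hilbert-Schmidt product and
      the adjoint can be moved to the other side.\<close>
    have tr: "mat_trace (pure_state z * hs_adjoint d twirl (F j)) = hs_inner (twirl (pure_state z)) (F j)"
      if "z \<in> carrier_vec d" for z
      using hs_inner_adjoint_twirl[OF pure_state_carrier[OF that] F]
      by (simp add: hs_inner_def[of "pure_state z"] pure_state_adjoint)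
    show "mat_trace (pure_state y * hs_adjoint d twirl (F j)) = mat_trace (pure_state x * hs_adjoint d twirl (F j))"
      unfolding tr[OF x] tr[OF y] by (simp only: same_image)
  qed
qed

end

section \<open>From scalar operators to the multiplicity count\<close>

theorem corollary10:
  fixes G :: "('g, 'b) monoid_scheme" and T :: "'g topology" and \<mu> :: "'g measure"
    and d :: nat and \<pi> :: "'g \<Rightarrow> complex mat" and U :: "complex mat"
    and s :: nat and m n :: "nat \<Rightarrow> nat" and \<sigma> :: "nat \<Rightarrow> 'g \<Rightarrow> complex mat"
  assumes "compact_group G T"
    and "normalized_haar_measure G T \<mu>"
    and "d > 1"
    and "unitary_representation G T d \<pi>"
    and "\<And>\<alpha>. \<alpha> < s \<Longrightarrow> unitary_representation G T (n \<alpha>) (\<sigma> \<alpha>)"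
    and "\<And>\<alpha>. \<alpha> < s \<Longrightarrow> irreducible_representation G (n \<alpha>) (\<sigma> \<alpha>)"
    and "\<And>\<alpha> \<beta>. \<alpha> < s \<Longrightarrow> \<beta> < s \<Longrightarrow> \<alpha> \<noteq> \<beta> \<Longrightarrow>
           \<not> equivalent_representations G (n \<alpha>) (\<sigma> \<alpha>) (n \<beta>) (\<sigma> \<beta>)"
    and "\<And>\<alpha>. \<alpha> < s \<Longrightarrow> m \<alpha> \<ge> 1"
    and "unitary_mat d U"
    and "\<And>g. g \<in> carrier G \<Longrightarrow>
           U * \<pi> g * mat_adjoint U =
             diag_block_mat (map (\<lambda>\<alpha>. kronecker (1\<^sub>m (m \<alpha>)) (\<sigma> \<alpha> g)) [0..<s])"
    and "int (\<Sum>\<alpha><s. (m \<alpha>)\<^sup>2) \<le> N_bound d"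
  shows "\<not> phase_retrievable d d (twirling_channel G \<mu> d \<pi>)"
proof
  assume pr: "phase_retrievable d d (twirling_channel G \<mu> d \<pi>)"
  interpret haar_representation G T \<mu> d \<pi> by unfold_locales fact+
  have U: "U \<in> carrier_mat d d" "U * mat_adjoint U = 1\<^sub>m d"
    using assms(9) unfolding unitary_mat_def by auto
  have \<sigma>: "\<sigma> \<alpha> g \<in> carrier_mat (n \<alpha>) (n \<alpha>)" if "\<alpha> < s" "g \<in> carrier G" for \<alpha> g
    using assms(5)[OF that(1)] that(2) unfolding unitary_representation_def unitary_mat_def by simp
  have dims: "dim_row (kronecker (1\<^sub>m (m \<alpha>)) (\<sigma> \<alpha> g)) = m \<alpha> * n \<alpha>"
    "dim_col (kronecker (1\<^sub>m (m \<alpha>)) (\<sigma> \<alpha> g)) = m \<alpha> * n \<alpha>" if "\<alpha> < s" "g \<in> carrier G" for \<alpha> g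
    using \<sigma>[OF that] by (auto simp: kronecker_def)
  \<comment> \<open>The quantifier order is essential: for each g, one c serves all
    \<alpha>.\<close>
  have scalars: "\<exists>c. \<forall>\<alpha><s. \<sigma> \<alpha> g = c \<cdot>\<^sub>m 1\<^sub>m (n \<alpha>)" if g: "g \<in> carrier G" for g
  proof -
    obtain c where c: "\<pi> g = c \<cdot>\<^sub>m 1\<^sub>m d"
      using phase_retrievable_imp_scalar[OF pr _ g] assms(3) by auto
    have "U * \<pi> g * mat_adjoint U = (c \<cdot>\<^sub>m U) * mat_adjoint U"
      using U(1) unfolding c by (simp add: mult_smult_distrib[of _ d d _ d])
    also have "\<dots> = c \<cdot>\<^sub>m 1\<^sub>m d"
      using U mult_smult_assoc_mat[OF U(1) mat_adjoint_carrier[OF U(1)]] by simp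
    finally have blocks: "diag_block_mat (map (\<lambda>\<alpha>. kronecker (1\<^sub>m (m \<alpha>)) (\<sigma> \<alpha> g)) [0..<s]) = c \<cdot>\<^sub>m 1\<^sub>m d"
      using assms(10)[OF g] by simp
    have "\<sigma> \<alpha> g = c \<cdot>\<^sub>m 1\<^sub>m (n \<alpha>)" if \<alpha>: "\<alpha> < s" for \<alpha>
    proof (rule kronecker_one_scalar[OF \<sigma>[OF \<alpha> g] assms(8)[OF \<alpha>]])
      show "kronecker (1\<^sub>m (m \<alpha>)) (\<sigma> \<alpha> g) = c \<cdot>\<^sub>m 1\<^sub>m (dim_row (kronecker (1\<^sub>m (m \<alpha>)) (\<sigma> \<alpha> g)))"
        by (rule diag_block_mat_scalar[OF blocks]) (use \<alpha> g dims in auto)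
    qed
    thus ?thesis by blast
  qed
  have n1: "n \<alpha> = 1" if \<alpha>: "\<alpha> < s" for \<alpha>
    using irreducible_scalar_dim[OF assms(6)[OF \<alpha>]] scalars \<alpha> by blast
  have same: "\<sigma> \<alpha> g = \<sigma> \<beta> g" if "\<alpha> < s" "\<beta> < s" "g \<in> carrier G" for \<alpha> \<beta> g
    using scalars[OF that(3)] that n1 by metis
  have "s \<le> 1"
  proof (rule ccontr)
    assume "\<not> s \<le> 1"
    hence s: "0 < s" "1 < s" by auto
    \<comment> \<open>Two constituents of dimension 1 that coincide are intertwined by the 1 by 1
      identity.\<close>
    have "equivalent_representations G (n 0) (\<sigma> 0) (n 1) (\<sigma> 1)"
      unfolding equivalent_representations_def
    proof (intro bexI[of _ "1\<^sub>m 1"] conjI ballI)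
      fix g assume g: "g \<in> carrier G"
      show "1\<^sub>m 1 * \<sigma> 0 g = \<sigma> 1 g * 1\<^sub>m 1"
        using same[OF s g] \<sigma>[OF s(1) g] n1[OF s(1)] by simp
    qed (use n1 s in \<open>auto simp: invertible_mat_def inverts_mat_def intro!: exI[of _ "1\<^sub>m 1"]\<close>)
    thus False using assms(7)[OF s] by simp
  qed
  \<comment> \<open>Only sizes are compared, so evaluating the decomposition at the identity element
    suffices.\<close>
  moreover have dim: "d = sum_list (map (\<lambda>\<alpha>. m \<alpha> * n \<alpha>) [0..<s])"
  proof -
    have "d = dim_row (U * \<pi> \<one>\<^bsub>G\<^esub> * mat_adjoint U)" using U by simp
    also have "\<dots> = sum_list (map (\<lambda>\<alpha>. m \<alpha> * n \<alpha>) [0..<s])"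
      unfolding assms(10)[OF one_closed] dim_diag_block_mat
      by (auto simp: o_def dims intro!: arg_cong[of _ _ sum_list])
    finally show ?thesis .
  qed
  \<comment> \<open>With s = 0 the sum would be empty and d would be 0.\<close>
  ultimately have "s = 1" using assms(3) by (cases s) auto
  hence "d = m 0" using dim n1[of 0] by simp
  hence "int (d\<^sup>2) \<le> N_bound d" using assms(11) \<open>s = 1\<close> by simp
  thus False using N_bound_less[OF assms(3)] by simp
qed

end
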